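(* Consider a random walk $P$ in the quarter-plane and its invariant measure $m$. If $m$ is induced by a finite set $\Gamma\subset C$, where $\Gamma$ contains only non-degenerate geometric terms (i.e. $\rho>0$ and $\sigma>0$ for every $(\rho,\sigma)\in\Gamma$), then $\Gamma$ is pairwise-coupled.
   Context: Random walk in the quarter-plane: a discrete-time Markov chain on $S=\mathbb{N}_0\times\mathbb{N}_0$ determined by non-negative parameters $p_{s,t}$, $h_s$, $v_t$ ($s,t\in\{-1,0,1\}$) with the following transitions. From $(i,j)$ with $i>0,j>0$: to $(i+s,j+t)$ with probability $p_{s,t}$. From $(i,0)$ with $i>0$: to $(i+s,0)$ with probability $h_s$ and to $(i+s,1)$ with probability $p_{s,1}$. From $(0,j)$ with $j>0$: to $(0,j+t)$ with probability $v_t$ and to $(1,j+t)$ with probability $p_{1,t}$. From $(0,0)$: to $(1,0)$ with probability $h_1$, to $(0,1)$ with probability $v_1$, to $(1,1)$ with probability $p_{1,1}$, and to $(0,0)$ with the remaining probability $1-h_1-v_1-p_{1,1}\ge 0$. (Transition probabilities out of each state sum to 1.) The chain is assumed irreducible, aperiodic and positive recurrent. Invariant measure: the (up to a multiplicative constant unique) positive measure $m$ on $S$ satisfying, for all $i>0$, $j>0$, $m(i,j)=\sum_{s=-1}^{1}\sum_{t=-1}^{1}m(i-s,j-t)p_{s,t}$, $m(i,0)=\sum_{s=-1}^{1}m(i-s,1)p_{s,-1}+\sum_{s=-1}^{1}m(i-s,0)h_s$, $m(0,j)=\sum_{t=-1}^{1}m(1,j-t)p_{-1,t}+\sum_{t=-1}^{1}m(0,j-t)v_t$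 (the balance equation at the origin is implied by these). Induced measure: a (signed) measure $m$ on $S$ is induced by $\Gamma$ if $m(i,j)=\sum_{(\rho,\sigma)\in\Gamma}\alpha(\rho,\sigma)\rho^i\sigma^j$ for all $(i,j)\in S$, with $\alpha(\rho,\sigma)\in\mathbb{R}\setminus\{0\}$ for all $(\rho,\sigma)\in\Gamma$. $C=\{(\rho,\sigma)\in[0,1)^2 : Q(\rho,\sigma)=0\}$, where $Q(\rho,\sigma)=\rho\sigma\left(\sum_{s=-1}^{1}\sum_{t=-1}^{1}\rho^{-s}\sigma^{-t}p_{s,t}-1\right)$, regarded as a polynomial. Uncoupled partition: a partition $\{\Gamma_1,\Gamma_2,\dots\}$ of $\Gamma$ is uncoupled if, whenever $(\rho,\sigma)\in\Gamma_p$ and $(\tilde\rho,\tilde\sigma)\in\Gamma_q$ with $p\ne q$, both $\tilde\rho\ne\rho$ and $\tilde\sigma\ne\sigma$. The maximal uncoupled partition is the uncoupled partition with the largest number of sets (it is unique). A set $\Gamma\subset C$ is pairwise-coupled if and only if its maximal uncoupled partition contains only one set. *)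

theory Defs
  imports "HOL-Analysis.Analysis" "HOL-Library.Disjoint_Sets" "HOL-Library.Equipollence"
begin

section \<open>Countable-state Markov chains given by a transition function\<close>

text \<open>
  Here \<open>K x y\<close> is the one-step probability of moving from \<open>x\<close> to \<open>y\<close>; \<open>K\<close> is meant to be
  stochastic, in which case all infinite sums below converge.
\<close>

primrec n_step :: "('a \<Rightarrow> 'a \<Rightarrow> real) \<Rightarrow> nat \<Rightarrow> 'a \<Rightarrow> 'a \<Rightarrow> real" where
  "n_step K 0 x y = (if x = y then 1 else 0)"
| "n_step K (Suc n) x y = (\<Sum>\<^sub>\<infinity>z. K x z * n_step K n z y)"

text \<open>\<open>first_passage K n x y\<close> is the probability that the chain started in \<open>x\<close> visits \<open>y\<close> at
  time \<open>n\<close> and at none of the times \<open>1, \<dots>, n - 1\<close>.\<close>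

fun first_passage :: "('a \<Rightarrow> 'a \<Rightarrow> real) \<Rightarrow> nat \<Rightarrow> 'a \<Rightarrow> 'a \<Rightarrow> real" where
  "first_passage K 0 x y = 0"
| "first_passage K (Suc 0) x y = K x y"
| "first_passage K (Suc (Suc n)) x y = (\<Sum>\<^sub>\<infinity>z\<in>-{y}. K x z * first_passage K (Suc n) z y)"

definition irreducible_chain :: "('a \<Rightarrow> 'a \<Rightarrow> real) \<Rightarrow> bool" where
  "irreducible_chain K \<longleftrightarrow> (\<forall>x y. \<exists>n. n_step K n x y > 0)"

definition aperiodic_chain :: "('a \<Rightarrow> 'a \<Rightarrow> real) \<Rightarrow> bool" where
  "aperiodic_chain K \<longleftrightarrow> (\<forall>x. Gcd {n. n > 0 \<and> n_step K n x x > 0} = 1)"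

text \<open>Return to each state is almost sure, with finite expected return time.\<close>

definition positive_recurrent_chain :: "('a \<Rightarrow> 'a \<Rightarrow> real) \<Rightarrow> bool" where
  "positive_recurrent_chain K \<longleftrightarrow>
     (\<forall>x. (\<lambda>n. first_passage K n x x) sums 1 \<and>
          summable (\<lambda>n. real n * first_passage K n x x))"


section \<open>Random walks in the quarter-plane\<close>

text \<open>
  Only the values of \<open>p\<close>, \<open>h\<close>, \<open>v\<close> at arguments in \<open>{-1..1}\<close> matter. The four conditions
  after nonnegativity say that the transition probabilities out of the interior, the
  horizontal axis, the vertical axis and the origin sum to one.
\<close>

definition walk_parameters ::
    "(int \<Rightarrow> int \<Rightarrow> real) \<Rightarrow> (int \<Rightarrow> real) \<Rightarrow> (int \<Rightarrow> real) \<Rightarrow> bool" where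
  "walk_parameters p h v \<longleftrightarrow>
     (\<forall>s\<in>{-1..1}. \<forall>t\<in>{-1..1}. p s t \<ge> 0) \<and>
     (\<forall>s\<in>{-1..1}. h s \<ge> 0) \<and>
     (\<forall>t\<in>{-1..1}. v t \<ge> 0) \<and>
     (\<Sum>s\<in>{-1..1}. \<Sum>t\<in>{-1..1}. p s t) = 1 \<and>
     (\<Sum>s\<in>{-1..1}. h s) + (\<Sum>s\<in>{-1..1}. p s 1) = 1 \<and>
     (\<Sum>t\<in>{-1..1}. v t) + (\<Sum>t\<in>{-1..1}. p 1 t) = 1 \<and>
     1 - h 1 - v 1 - p 1 1 \<ge> 0"

fun walk_transition ::
    "(int \<Rightarrow> int \<Rightarrow> real) \<Rightarrow> (int \<Rightarrow> real) \<Rightarrow> (int \<Rightarrow> real) \<Rightarrow> nat \<times> nat \<Rightarrow> nat \<times> nat \<Rightarrow> real" where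
  "walk_transition p h v (i, j) (k, l) =
     (let s = int k - int i; t = int l - int j in
      if \<bar>s\<bar> > 1 \<or> \<bar>t\<bar> > 1 then 0
      else if i > 0 \<and> j > 0 then p s t
      else if i > 0 then (if t = 0 then h s else p s 1)
      else if j > 0 then (if s = 0 then v t else p 1 t)
      else if s = 1 \<and> t = 0 then h 1
      else if s = 0 \<and> t = 1 then v 1
      else if s = 1 \<and> t = 1 then p 1 1
      else 1 - h 1 - v 1 - p 1 1)"

definition quarter_plane_walk ::
    "(int \<Rightarrow> int \<Rightarrow> real) \<Rightarrow> (int \<Rightarrow> real) \<Rightarrow> (int \<Rightarrow> real) \<Rightarrow> bool" where
  "quarter_plane_walk p h v \<longleftrightarrow>
     walk_parameters p h v \<and>
     irreducible_chain (walk_transition p h v) \<and>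
     aperiodic_chain (walk_transition p h v) \<and>
     positive_recurrent_chain (walk_transition p h v)"

text \<open>
  A positive measure is taken to be nonnegative and not identically zero. In the balance
  equations the arguments of \<open>nat\<close> are never negative, since \<open>i, j > 0\<close> and \<open>s, t \<le> 1\<close>.
\<close>

definition invariant_measure ::
    "(int \<Rightarrow> int \<Rightarrow> real) \<Rightarrow> (int \<Rightarrow> real) \<Rightarrow> (int \<Rightarrow> real) \<Rightarrow> (nat \<Rightarrow> nat \<Rightarrow> real) \<Rightarrow> bool" where
  "invariant_measure p h v m \<longleftrightarrow>
     (\<forall>i j. m i j \<ge> 0) \<and> (\<exists>i j. m i j \<noteq> 0) \<and>
     (\<forall>i>0. \<forall>j>0. m i j =
        (\<Sum>s\<in>{-1..1}. \<Sum>t\<in>{-1..1}. m (nat (int i - s)) (nat (int j - t)) * p s t)) \<and>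
     (\<forall>i>0. m i 0 =
        (\<Sum>s\<in>{-1..1}. m (nat (int i - s)) 1 * p s (-1)) +
        (\<Sum>s\<in>{-1..1}. m (nat (int i - s)) 0 * h s)) \<and>
     (\<forall>j>0. m 0 j =
        (\<Sum>t\<in>{-1..1}. m 1 (nat (int j - t)) * p (-1) t) +
        (\<Sum>t\<in>{-1..1}. m 0 (nat (int j - t)) * v t))"


section \<open>Sums of geometric terms\<close>

definition induced_by :: "(nat \<Rightarrow> nat \<Rightarrow> real) \<Rightarrow> (real \<times> real) set \<Rightarrow> bool" where
  "induced_by m \<Gamma> \<longleftrightarrow>
     (\<exists>\<alpha> :: real \<times> real \<Rightarrow> real. (\<forall>x\<in>\<Gamma>. \<alpha> x \<noteq> 0) \<and>
        (\<forall>i j. ((\<lambda>(\<rho>, \<sigma>). \<alpha> (\<rho>, \<sigma>) * \<rho> ^ i * \<sigma> ^ j) has_sum m i j) \<Gamma>))"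

text \<open>
  The kernel \<open>\<rho>\<sigma>(\<Sum>\<^sub>s \<Sum>\<^sub>t \<rho>\<^bsup>-s\<^esup>\<sigma>\<^bsup>-t\<^esup> p s t - 1)\<close> with the factor \<open>\<rho>\<sigma>\<close> multiplied in, so that it
  is a polynomial and has the right value also when \<open>\<rho> = 0\<close> or \<open>\<sigma> = 0\<close>.
\<close>

definition walk_poly :: "(int \<Rightarrow> int \<Rightarrow> real) \<Rightarrow> real \<Rightarrow> real \<Rightarrow> real" where
  "walk_poly p \<rho> \<sigma> =
     (\<Sum>s\<in>{-1..1}. \<Sum>t\<in>{-1..1}. \<rho> ^ nat (1 - s) * \<sigma> ^ nat (1 - t) * p s t) - \<rho> * \<sigma>"

definition walk_curve :: "(int \<Rightarrow> int \<Rightarrow> real) \<Rightarrow> (real \<times> real) set" where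
  "walk_curve p = {(\<rho>, \<sigma>). \<rho> \<in> {0..<1} \<and> \<sigma> \<in> {0..<1} \<and> walk_poly p \<rho> \<sigma> = 0}"


section \<open>Uncoupled partitions\<close>

definition uncoupled_partition :: "(real \<times> real) set \<Rightarrow> (real \<times> real) set set \<Rightarrow> bool" where
  "uncoupled_partition \<Gamma> P \<longleftrightarrow>
     partition_on \<Gamma> P \<and>
     (\<forall>A\<in>P. \<forall>B\<in>P. A \<noteq> B \<longrightarrow>
        (\<forall>(\<rho>, \<sigma>)\<in>A. \<forall>(\<rho>', \<sigma>')\<in>B. \<rho>' \<noteq> \<rho> \<and> \<sigma>' \<noteq> \<sigma>))"

text \<open>
  The number of sets is compared by \<open>\<lesssim>\<close> rather than \<open>card\<close>, so that infinite partitions are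
  not counted as having no sets.
\<close>

definition maximal_uncoupled_partition ::
    "(real \<times> real) set \<Rightarrow> (real \<times> real) set set \<Rightarrow> bool" where
  "maximal_uncoupled_partition \<Gamma> P \<longleftrightarrow>
     uncoupled_partition \<Gamma> P \<and> (\<forall>P'. uncoupled_partition \<Gamma> P' \<longrightarrow> P' \<lesssim> P)"

text \<open>
  If some maximal uncoupled partition has exactly one set, then it is \<open>{\<Gamma>}\<close> and it is the only
  uncoupled partition, so the existential quantifier involves no choice.
\<close>

definition pairwise_coupled :: "(real \<times> real) set \<Rightarrow> bool" where
  "pairwise_coupled \<Gamma> \<longleftrightarrow> (\<exists>P. maximal_uncoupled_partition \<Gamma> P \<and> card P = 1)"

end

theory Submission
  imports Defs "HOL-Computational_Algebra.Polynomial"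
begin

text \<open>
  The terms of \<open>\<Gamma>\<close> solve the interior balance equation one by one, while the balance equations
  on the horizontal (vertical) axis separate, by linear independence of the sequences
  \<open>\<rho>\<^sup>i\<close> (\<open>\<sigma>\<^sup>j\<close>), into one equation for each \<open>\<rho>\<close> (\<open>\<sigma>\<close>). So rescaling the
  coefficients by one constant per set of an uncoupled partition preserves all balance equations. If
  the partition has two sets, the constants, not both zero, can be chosen so that the resulting
  summable signed measure vanishes at the origin. For an irreducible chain such a measure is
  zero: its absolute value is invariant because it is subinvariant and the total mass is preserved.
  This contradicts the linear independence of the geometric terms.
\<close>

section \<open>Signed invariant measures of irreducible chains\<close>

lemma n_step_nonneg:
  assumes "\<And>x y. K x y \<ge> 0"
  shows "n_step K n x y \<ge> 0"
  by (induction n arbitrary: x) (auto intro!: infsum_nonneg mult_nonneg_nonneg assms)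

text \<open>By the triangle inequality, \<open>\<bar>\<mu> y\<bar>\<close> is at most the mass
  \<open>c y\<close> that one step of the chain moves from \<open>\<bar>\<mu>\<bar>\<close> into
  \<open>y\<close>; at \<open>z\<close>, which has no balance equation, this is clear from
  \<open>\<mu> z = 0\<close>. Stochastic rows preserve the total mass, so equality holds everywhere.
  A zero of \<open>\<mu>\<close> then spreads to all predecessors, and by irreducibility every state
  leads to \<open>z\<close>.\<close>

lemma signed_invariant_zero:
  fixes K :: "'a \<Rightarrow> 'a \<Rightarrow> real" and \<mu> :: "'a \<Rightarrow> real"
  assumes nonneg: "\<And>x y. K x y \<ge> 0"
    and rows: "\<And>x. (K x has_sum 1) UNIV"
    and irr: "irreducible_chain K"
    and abs_sum: "(\<lambda>x. \<bar>\<mu> x\<bar>) summable_on UNIV"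
    and balance: "\<And>y. y \<noteq> z \<Longrightarrow> ((\<lambda>x. \<mu> x * K x y) has_sum \<mu> y) UNIV"
    and "\<mu> z = 0"
  shows "\<mu> x = 0"
proof -
  define M where "M = (\<Sum>\<^sub>\<infinity>x. \<bar>\<mu> x\<bar>)"
  have M: "((\<lambda>x. \<bar>\<mu> x\<bar>) has_sum M) UNIV"
    unfolding M_def using abs_sum by (rule has_sum_infsum)
  have row: "((\<lambda>y. \<bar>\<mu> x\<bar> * K x y) has_sum \<bar>\<mu> x\<bar>) UNIV" for x
    using has_sum_cmult_right[OF rows, of "\<bar>\<mu> x\<bar>" x] by simp
  \<comment> \<open>The flow \<open>\<bar>\<mu> x\<bar> * K x y\<close> is summed over all pairs in
    both orders: its row sums add up to \<open>M\<close>, hence so do its column sums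
    \<open>c y\<close>.\<close>
  have summable: "(\<lambda>(x, y). \<bar>\<mu> x\<bar> * K x y) summable_on UNIV \<times> UNIV"
    by (rule summable_on_SigmaI[OF _ abs_sum]) (use row nonneg in auto)
  have total: "((\<lambda>(x, y). \<bar>\<mu> x\<bar> * K x y) has_sum M) (UNIV \<times> UNIV)"
    by (rule has_sum_SigmaI[OF _ M summable]) (use row in auto)
  hence total': "((\<lambda>(y, x). \<bar>\<mu> x\<bar> * K x y) has_sum M) (UNIV \<times> UNIV)"
    by (subst (asm) has_sum_swap) (simp add: case_prod_unfold)
  define c where "c y = (\<Sum>\<^sub>\<infinity>x. \<bar>\<mu> x\<bar> * K x y)" for y
  have "(\<lambda>x. \<bar>\<mu> x\<bar> * K x y) summable_on UNIV" for y
    using summable_on_SigmaD1[OF has_sum_imp_summable[OF total'], of y] by simp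
  hence col: "((\<lambda>x. \<bar>\<mu> x\<bar> * K x y) has_sum c y) UNIV" for y
    unfolding c_def by (rule has_sum_infsum)
  have c_sum: "(c has_sum M) UNIV"
    by (rule has_sum_SigmaD[OF total']) (use col in auto)
  have le: "\<bar>\<mu> y\<bar> \<le> c y" for y
  proof (cases "y = z")
    case True
    thus ?thesis using \<open>\<mu> z = 0\<close> nonneg unfolding c_def by (auto intro!: infsum_nonneg)
  next
    case False
    have "\<mu> y \<le> c y"
      by (rule has_sum_mono[OF balance[OF False] col]) (auto intro!: mult_right_mono nonneg)
    moreover have "- c y \<le> \<mu> y"
    proof (rule has_sum_mono[OF _ balance[OF False]])
      show "((\<lambda>x. - \<bar>\<mu> x\<bar> * K x y) has_sum - c y) UNIV"
        using col[of y] by (simp add: has_sum_uminus)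
    qed (intro mult_right_mono nonneg, simp)
    ultimately show ?thesis by linarith
  qed
  have "((\<lambda>y. c y - \<bar>\<mu> y\<bar>) has_sum 0) UNIV"
    using has_sum_add[OF c_sum has_sum_uminusI[OF M]] by simp
  hence c_eq: "c y = \<bar>\<mu> y\<bar>" for y
    using nonneg_has_sum_le_0D[of "\<lambda>y. c y - \<bar>\<mu> y\<bar>" UNIV 0 y] le by simp
  have step: "\<mu> x = 0" if "\<mu> w = 0" "K x w > 0" for x w
  proof -
    have "((\<lambda>x. \<bar>\<mu> x\<bar> * K x w) has_sum 0) UNIV"
      using col[of w] c_eq[of w] that by simp
    hence "\<bar>\<mu> x\<bar> * K x w = 0"
      using nonneg_has_sum_le_0D[of "\<lambda>x. \<bar>\<mu> x\<bar> * K x w" UNIV 0 x] nonneg by simp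
    thus ?thesis using that by simp
  qed
  have reach: "n_step K n x z > 0 \<Longrightarrow> \<mu> x = 0" for n x
  proof (induction n arbitrary: x)
    case 0
    thus ?case using \<open>\<mu> z = 0\<close> by (auto split: if_splits)
  next
    case (Suc n)
    hence "(\<Sum>\<^sub>\<infinity>w. K x w * n_step K n w z) \<noteq> 0" by simp
    \<comment> \<open>A nonzero infinite sum has a nonzero term; this direction asks for no
      summability.\<close>
    then obtain w where "K x w * n_step K n w z \<noteq> 0"
      using infsum_0[of UNIV "\<lambda>w. K x w * n_step K n w z"] by blast
    hence "K x w > 0" "n_step K n w z > 0"
      using nonneg[of x w] n_step_nonneg[of K n w z] nonneg by (auto simp: less_le)
    thus ?case using Suc.IH step by blast
  qed
  show ?thesis using irr reach unfolding irreducible_chain_def by blast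
qed

section \<open>The balance equations of the walk\<close>

text \<open>The equations of \<open>invariant_measure\<close> without nonnegativity and
  nontriviality, so that signed combinations qualify.\<close>

definition balanced ::
    "(int \<Rightarrow> int \<Rightarrow> real) \<Rightarrow> (int \<Rightarrow> real) \<Rightarrow> (int \<Rightarrow> real) \<Rightarrow> (nat \<Rightarrow> nat \<Rightarrow> real) \<Rightarrow> bool" where
  "balanced p h v m \<longleftrightarrow>
     (\<forall>i>0. \<forall>j>0. m i j =
        (\<Sum>s\<in>{-1..1}. \<Sum>t\<in>{-1..1}. m (nat (int i - s)) (nat (int j - t)) * p s t)) \<and>
     (\<forall>i>0. m i 0 =
        (\<Sum>s\<in>{-1..1}. m (nat (int i - s)) 1 * p s (-1)) +
        (\<Sum>s\<in>{-1..1}. m (nat (int i - s)) 0 * h s)) \<and>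
     (\<forall>j>0. m 0 j =
        (\<Sum>t\<in>{-1..1}. m 1 (nat (int j - t)) * p (-1) t) +
        (\<Sum>t\<in>{-1..1}. m 0 (nat (int j - t)) * v t))"

lemma steps_eq: "{-1..1} = {-1, 0, 1 :: int}"
  by auto

lemma walk_transition_nonneg:
  assumes "walk_parameters p h v"
  shows "walk_transition p h v x y \<ge> 0"
proof -
  have unit: "s \<in> {-1..1}" if "\<not> \<bar>s\<bar> > 1" for s :: int
    using that by auto
  have pos: "\<not> \<bar>s\<bar> > 1 \<Longrightarrow> \<not> \<bar>t\<bar> > 1 \<Longrightarrow> p s t \<ge> 0"
    "\<not> \<bar>s\<bar> > 1 \<Longrightarrow> h s \<ge> 0" "\<not> \<bar>s\<bar> > 1 \<Longrightarrow> v s \<ge> 0" for s t :: int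
    using assms unit unfolding walk_parameters_def by blast+
  have "1 - h 1 - v 1 - p 1 1 \<ge> 0"
    using assms unfolding walk_parameters_def by blast
  \<comment> \<open>The body of \<open>walk_transition\<close> with free integers \<open>a\<close>,
    \<open>b\<close> as displacement, which keeps differences of casts out of the case
    analysis.\<close>
  hence "(let s = a; t = b in
      if \<bar>s\<bar> > 1 \<or> \<bar>t\<bar> > 1 then 0
      else if i > 0 \<and> j > 0 then p s t
      else if i > 0 then (if t = 0 then h s else p s 1)
      else if j > 0 then (if s = 0 then v t else p 1 t)
      else if s = 1 \<and> t = 0 then h 1
      else if s = 0 \<and> t = 1 then v 1
      else if s = 1 \<and> t = 1 then p 1 1
      else 1 - h 1 - v 1 - p 1 1) \<ge> 0" for i j :: nat and a b :: int
    unfolding Let_def by (auto intro: pos)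
  thus ?thesis by (cases x; cases y) (simp only: walk_transition.simps)
qed

lemma walk_transition_far:
  assumes "fst y \<notin> {fst x - 1, fst x, fst x + 1} \<or> snd y \<notin> {snd x - 1, snd x, snd x + 1}"
  shows "walk_transition p h v x y = 0"
proof (cases x; cases y)
  fix i j k l assume "x = (i, j)" "y = (k, l)"
  moreover from this have "\<bar>int k - int i\<bar> > 1 \<or> \<bar>int l - int j\<bar> > 1"
    using assms by auto
  ultimately show ?thesis by (simp only: walk_transition.simps Let_def if_True)
qed

lemma walk_transition_row:
  assumes "walk_parameters p h v"
  shows "(walk_transition p h v x has_sum 1) UNIV"
proof (cases x)
  case (Pair i j)
  \<comment> \<open>Truncated subtraction turns \<open>i - 1\<close> into \<open>i\<close> when
    \<open>i = 0\<close>, so \<open>N\<close> consists of exactly the neighbours that lie in the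
    quadrant.\<close>
  define N where "N = {i - 1, i, i + 1} \<times> {j - 1, j, j + 1}"
  have "sum (walk_transition p h v x) N = 1"
    using assms unfolding N_def Pair
    by (cases i; cases j)
      (simp_all add: walk_parameters_def steps_eq Let_def flip: sum.cartesian_product)
  moreover have "walk_transition p h v x y = 0" if "y \<notin> N" for y
    using that unfolding N_def Pair mem_Times_iff by (intro walk_transition_far) auto
  ultimately show ?thesis
    by (intro has_sum_finite_neutralI[of N]) (auto simp: N_def)
qed

text \<open>An axis is left only by a step of +1 away from it, and such steps have the interior
  probabilities. This and the next two lemmas show that the entries of one column depend on the
  displacement as in the balance equation of the target, even when the source lies on another part
  of the boundary.\<close>

lemma walk_transition_to_interior:
  assumes "i > 0" "j > 0" "\<bar>int i - int k\<bar> \<le> 1" "\<bar>int j - int l\<bar> \<le> 1"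
  shows "walk_transition p h v (k, l) (i, j) = p (int i - int k) (int j - int l)"
proof -
  have "k = 0 \<Longrightarrow> int i = 1" "l = 0 \<Longrightarrow> int j = 1" using assms by auto
  thus ?thesis using assms by (cases "k = 0"; cases "l = 0") (auto simp: Let_def)
qed

lemma walk_transition_to_horizontal:
  assumes "i > 0" "\<bar>int i - int k\<bar> \<le> 1" "l \<le> 1"
  shows "walk_transition p h v (k, l) (i, 0) =
    (if l = 0 then h (int i - int k) else p (int i - int k) (-1))"
proof -
  have "k = 0 \<Longrightarrow> int i = 1" "l = 0 \<or> l = 1" using assms by auto
  thus ?thesis using assms by (cases "k = 0") (auto simp: Let_def)
qed

lemma walk_transition_to_vertical:
  assumes "j > 0" "\<bar>int j - int l\<bar> \<le> 1" "k \<le> 1"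
  shows "walk_transition p h v (k, l) (0, j) =
    (if k = 0 then v (int j - int l) else p (-1) (int j - int l))"
proof -
  have "l = 0 \<Longrightarrow> int j = 1" "k = 0 \<or> k = 1" using assms by auto
  thus ?thesis using assms by (cases "l = 0") (auto simp: Let_def)
qed

text \<open>Turns the balance equations into column sums of the transition function, the form that
  \<open>signed_invariant_zero\<close> expects with the origin as exceptional state.\<close>

lemma balanced_column:
  assumes "balanced p h v m" "y \<noteq> (0, 0)"
  shows "((\<lambda>x. case_prod m x * walk_transition p h v x y) has_sum case_prod m y) UNIV"
proof (cases y)
  case (Pair i j)
  define N where "N = {i - 1, i, i + 1} \<times> {j - 1, j, j + 1}"
  have nat: "nat (2 + int n) = Suc (Suc n)" "nat (1 + int n) = Suc n" for n
    by auto
  note bal = assms(1)[unfolded balanced_def]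
  have "(\<Sum>x\<in>N. case_prod m x * walk_transition p h v x y) = case_prod m y"
  proof (cases i; cases j)
    fix a b assume "i = Suc a" "j = Suc b"
    thus ?thesis using bal[THEN conjunct1, rule_format, of "Suc a" "Suc b"]
      unfolding N_def Pair
      by (simp add: steps_eq walk_transition_to_interior nat
          del: walk_transition.simps flip: sum.cartesian_product)
  next
    fix a assume "i = Suc a" "j = 0"
    thus ?thesis using bal[THEN conjunct2, THEN conjunct1, rule_format, of "Suc a"]
      unfolding N_def Pair
      by (simp add: steps_eq walk_transition_to_horizontal nat
          del: walk_transition.simps flip: sum.cartesian_product)
  next
    fix b assume "i = 0" "j = Suc b"
    thus ?thesis using bal[THEN conjunct2, THEN conjunct2, rule_format, of "Suc b"]
      unfolding N_def Pair
      by (simp add: steps_eq walk_transition_to_vertical nat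
          del: walk_transition.simps flip: sum.cartesian_product)
  qed (use Pair assms(2) in auto)
  moreover have "walk_transition p h v x y = 0" if "x \<notin> N" for x
    using that unfolding N_def Pair mem_Times_iff by (intro walk_transition_far) auto
  ultimately show ?thesis
    by (intro has_sum_finite_neutralI[of N]) (auto simp: N_def)
qed

section \<open>Sums of geometric terms\<close>

lemma lagrange_interpolation:
  fixes F :: "'a::field \<Rightarrow> 'a"
  assumes "finite S"
  shows "\<exists>q. \<forall>x\<in>S. poly q x = F x"
  using assms
proof (induction S rule: finite_induct)
  case (insert a S)
  then obtain q where q: "\<forall>x\<in>S. poly q x = F x" by blast
  define r where "r = (\<Prod>y\<in>S. [:- y, 1:])"
  have "poly r a \<noteq> 0" "\<forall>x\<in>S. poly r x = 0"
    using insert unfolding r_def by (auto simp: poly_prod)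
  thus ?case using q
    by (intro exI[of _ "q + smult ((F a - poly q a) / poly r a) r"]) auto
qed auto

lemma sum_reweight:
  fixes f g :: "'b \<Rightarrow> 'a::field"
  assumes "finite \<Gamma>" "\<And>n. (\<Sum>x\<in>\<Gamma>. f x * g x ^ n) = 0"
  shows "(\<Sum>x\<in>\<Gamma>. f x * F (g x)) = 0"
proof -
  obtain q where q: "\<forall>y\<in>g ` \<Gamma>. poly q y = F y"
    using lagrange_interpolation assms(1) by blast
  have "(\<Sum>x\<in>\<Gamma>. f x * F (g x)) = (\<Sum>x\<in>\<Gamma>. f x * (\<Sum>n\<le>degree q. coeff q n * g x ^ n))"
    using q by (intro sum.cong) (auto simp flip: poly_altdef)
  also have "\<dots> = (\<Sum>n\<le>degree q. coeff q n * (\<Sum>x\<in>\<Gamma>. f x * g x ^ n))"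
    unfolding sum_distrib_left by (subst sum.swap) (simp add: algebra_simps)
  finally show ?thesis using assms(2) by simp
qed

definition geom_sum :: "(real \<times> real) set \<Rightarrow> (real \<times> real \<Rightarrow> real) \<Rightarrow> nat \<Rightarrow> nat \<Rightarrow> real" where
  "geom_sum \<Gamma> \<beta> i j = (\<Sum>x\<in>\<Gamma>. \<beta> x * fst x ^ i * snd x ^ j)"

text \<open>Reweighting by the indicator of \<open>snd x\<close> and then by that of
  \<open>fst x\<close> isolates the coefficient of \<open>x\<close>.\<close>

lemma geom_sum_eq_0D:
  assumes "finite \<Gamma>" "\<And>i j. geom_sum \<Gamma> \<beta> i j = 0" "x \<in> \<Gamma>"
  shows "\<beta> x = 0"
proof -
  have "(\<Sum>y\<in>\<Gamma>. \<beta> y * fst y ^ i * of_bool (snd y = snd x)) = 0" for i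
    using assms sum_reweight[of \<Gamma> "\<lambda>y. \<beta> y * fst y ^ i" snd "\<lambda>u. of_bool (u = snd x)"]
    unfolding geom_sum_def by simp
  hence "(\<Sum>y\<in>\<Gamma>. \<beta> y * of_bool (snd y = snd x) * of_bool (fst y = fst x)) = 0"
    using assms sum_reweight[of \<Gamma> "\<lambda>y. \<beta> y * of_bool (snd y = snd x)" fst
        "\<lambda>u. of_bool (u = fst x)"]
    by (simp add: mult_ac)
  also have "(\<Sum>y\<in>\<Gamma>. \<beta> y * of_bool (snd y = snd x) * of_bool (fst y = fst x))
      = (\<Sum>y\<in>\<Gamma>. if y = x then \<beta> y else 0)"
    by (intro sum.cong) (auto simp: prod_eq_iff)
  finally show ?thesis using assms by simp
qed

lemma geom_sum_abs_summable:
  assumes "\<And>x. x \<in> \<Gamma> \<Longrightarrow> \<bar>fst x\<bar> < 1 \<and> \<bar>snd x\<bar> < 1"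
  shows "(\<lambda>z. \<bar>case_prod (geom_sum \<Gamma> \<beta>) z\<bar>) summable_on UNIV"
proof -
  have geo: "((\<lambda>i. r ^ i) has_sum 1 / (1 - r)) UNIV" if "0 \<le> r" "r < 1" for r :: real
    using that by (intro sums_nonneg_imp_has_sum geometric_sums) auto
  have "(\<lambda>(i, j). \<bar>fst x\<bar> ^ i * \<bar>snd x\<bar> ^ j) summable_on UNIV \<times> UNIV" if "x \<in> \<Gamma>" for x
  proof (rule summable_on_SigmaI)
    show "((\<lambda>j. case (i, j) of (i, j) \<Rightarrow> \<bar>fst x\<bar> ^ i * \<bar>snd x\<bar> ^ j) has_sum
        \<bar>fst x\<bar> ^ i * (1 / (1 - \<bar>snd x\<bar>))) UNIV" for i
      using has_sum_cmult_right[OF geo[of "\<bar>snd x\<bar>"], of "\<bar>fst x\<bar> ^ i"] assms[OF that] by simp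
    show "(\<lambda>i. \<bar>fst x\<bar> ^ i * (1 / (1 - \<bar>snd x\<bar>))) summable_on UNIV"
      using geo[of "\<bar>fst x\<bar>"] assms[OF that]
      by (intro summable_on_cmult_left) (auto intro: has_sum_imp_summable)
  qed auto
  hence "(\<lambda>(i, j). fst x ^ i * snd x ^ j) summable_on UNIV" if "x \<in> \<Gamma>" for x
    using that by (subst summable_on_iff_abs_summable_on_real)
      (auto simp: abs_mult power_abs case_prod_unfold)
  \<comment> \<open>For infinite \<open>\<Gamma>\<close> the sum is 0 by convention, which is the
    first case of the induction.\<close>
  hence "(\<lambda>z. \<Sum>x\<in>\<Gamma>. \<beta> x * (case z of (i, j) \<Rightarrow> fst x ^ i * snd x ^ j)) summable_on UNIV"
    by (induction \<Gamma> rule: infinite_finite_induct)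
      (auto intro!: summable_on_add summable_on_cmult_right)
  hence "case_prod (geom_sum \<Gamma> \<beta>) summable_on UNIV"
    by (simp add: geom_sum_def[abs_def] case_prod_unfold mult.assoc)
  thus ?thesis
    by (subst (asm) summable_on_iff_abs_summable_on_real) simp
qed

section \<open>Balance equations for sums of geometric terms\<close>

text \<open>The defect, left side minus right side, of a single term \<rho>^i \<sigma>^j in the
  horizontal balance equation, with \<rho>^(i-1) factored out; \<open>q\<close> holds the
  probabilities of steps onto the axis. Swapping the coordinates gives the vertical axis.\<close>

definition axis_poly :: "(int \<Rightarrow> real) \<Rightarrow> (int \<Rightarrow> real) \<Rightarrow> real \<Rightarrow> real \<Rightarrow> real" where
  "axis_poly q h \<rho> \<sigma> = \<rho> - \<sigma> * (\<Sum>s\<in>{-1..1}. \<rho> ^ nat (1 - s) * q s)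
     - (\<Sum>s\<in>{-1..1}. \<rho> ^ nat (1 - s) * h s)"

text \<open>Each term leaves the kernel as its defect, so terms on the curve solve the interior
  equations with any coefficients.\<close>

lemma geom_sum_interior:
  assumes "i > 0" "j > 0"
  shows "(\<Sum>s\<in>{-1..1}. \<Sum>t\<in>{-1..1}. geom_sum \<Gamma> \<beta> (nat (int i - s)) (nat (int j - t)) * p s t)
      - geom_sum \<Gamma> \<beta> i j
    = (\<Sum>x\<in>\<Gamma>. \<beta> x * fst x ^ (i - 1) * snd x ^ (j - 1) * walk_poly p (fst x) (snd x))"
proof -
  obtain a b where "i = Suc a" "j = Suc b" using assms by (metis gr0_implies_Suc)
  have nat: "nat (2 + int n) = Suc (Suc n)" "nat (1 + int n) = Suc n" for n
    by auto
  show ?thesis unfolding \<open>i = _\<close> \<open>j = _\<close> geom_sum_def walk_poly_def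
    by (simp add: steps_eq nat sum_distrib_left sum_distrib_right flip: sum.distrib sum_subtractf)
      (rule sum.cong[OF refl]; simp add: algebra_simps power2_eq_square)
qed

lemma geom_sum_horizontal:
  assumes "i > 0"
  shows "geom_sum \<Gamma> \<beta> i 0 - ((\<Sum>s\<in>{-1..1}. geom_sum \<Gamma> \<beta> (nat (int i - s)) 1 * q s) +
      (\<Sum>s\<in>{-1..1}. geom_sum \<Gamma> \<beta> (nat (int i - s)) 0 * h s))
    = (\<Sum>x\<in>\<Gamma>. \<beta> x * axis_poly q h (fst x) (snd x) * fst x ^ (i - 1))"
proof -
  obtain a where "i = Suc a" using assms by (metis gr0_implies_Suc)
  have nat: "nat (2 + int n) = Suc (Suc n)" "nat (1 + int n) = Suc n" for n
    by auto
  show ?thesis unfolding \<open>i = _\<close> geom_sum_def axis_poly_def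
    by (simp add: steps_eq nat sum_distrib_left sum_distrib_right flip: sum.distrib sum_subtractf)
      (rule sum.cong[OF refl]; simp add: algebra_simps power2_eq_square)
qed

lemma geom_sum_vertical:
  assumes "j > 0"
  shows "geom_sum \<Gamma> \<beta> 0 j - ((\<Sum>t\<in>{-1..1}. geom_sum \<Gamma> \<beta> 1 (nat (int j - t)) * q t) +
      (\<Sum>t\<in>{-1..1}. geom_sum \<Gamma> \<beta> 0 (nat (int j - t)) * v t))
    = (\<Sum>x\<in>\<Gamma>. \<beta> x * axis_poly q v (snd x) (fst x) * snd x ^ (j - 1))"
proof -
  obtain a where "j = Suc a" using assms by (metis gr0_implies_Suc)
  have nat: "nat (2 + int n) = Suc (Suc n)" "nat (1 + int n) = Suc n" for n
    by auto
  show ?thesis unfolding \<open>j = _\<close> geom_sum_def axis_poly_def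
    by (simp add: steps_eq nat sum_distrib_left sum_distrib_right flip: sum.distrib sum_subtractf)
      (rule sum.cong[OF refl]; simp add: algebra_simps power2_eq_square)
qed

text \<open>The horizontal equations separate by \<rho> and admit any factor depending on \<rho>
  alone; the vertical ones likewise for \<sigma>. The weight \<open>g\<close> has both forms on
  \<open>\<Gamma>\<close>, and the interior equations hold term by term.\<close>

lemma balanced_reweight:
  assumes "finite \<Gamma>" "\<Gamma> \<subseteq> walk_curve p" "balanced p h v (geom_sum \<Gamma> \<alpha>)"
    and F: "\<And>x. x \<in> \<Gamma> \<Longrightarrow> g x = F (fst x)"
    and G: "\<And>x. x \<in> \<Gamma> \<Longrightarrow> g x = G (snd x)"
  shows "balanced p h v (geom_sum \<Gamma> (\<lambda>x. g x * \<alpha> x))"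
proof -
  let ?\<beta> = "\<lambda>x. g x * \<alpha> x" and ?H = "axis_poly (\<lambda>s. p s (-1)) h" and ?V = "axis_poly (p (-1)) v"
  \<comment> \<open>The equation at \<open>i = Suc n\<close> yields the power \<open>n\<close>, so
    all exponents from 0 on are available to \<open>sum_reweight\<close>.\<close>
  have hor: "(\<Sum>x\<in>\<Gamma>. \<alpha> x * ?H (fst x) (snd x) * fst x ^ n) = 0" for n
    using assms(3) geom_sum_horizontal[of "Suc n" \<Gamma> \<alpha> "\<lambda>s. p s (-1)" h]
    unfolding balanced_def by simp
  have ver: "(\<Sum>x\<in>\<Gamma>. \<alpha> x * ?V (snd x) (fst x) * snd x ^ n) = 0" for n
    using assms(3) geom_sum_vertical[of "Suc n" \<Gamma> \<alpha> "p (-1)" v]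
    unfolding balanced_def by simp
  have hor': "(\<Sum>x\<in>\<Gamma>. ?\<beta> x * ?H (fst x) (snd x) * fst x ^ n) = 0" for n
    using sum_reweight[OF assms(1) hor, of "\<lambda>\<rho>. F \<rho> * \<rho> ^ n"]
    by (simp add: F mult_ac)
  have ver': "(\<Sum>x\<in>\<Gamma>. ?\<beta> x * ?V (snd x) (fst x) * snd x ^ n) = 0" for n
    using sum_reweight[OF assms(1) ver, of "\<lambda>\<sigma>. G \<sigma> * \<sigma> ^ n"]
    by (simp add: G mult_ac)
  have "walk_poly p (fst x) (snd x) = 0" if "x \<in> \<Gamma>" for x
    using that assms(2) unfolding walk_curve_def by auto
  hence int: "(\<Sum>x\<in>\<Gamma>. ?\<beta> x * fst x ^ a * snd x ^ b * walk_poly p (fst x) (snd x)) = 0" for a b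
    by simp
  show ?thesis unfolding balanced_def
  proof (intro conjI allI impI)
    fix i j :: nat assume "i > 0" "j > 0"
    thus "geom_sum \<Gamma> ?\<beta> i j = (\<Sum>s\<in>{-1..1}. \<Sum>t\<in>{-1..1}.
        geom_sum \<Gamma> ?\<beta> (nat (int i - s)) (nat (int j - t)) * p s t)"
      using geom_sum_interior[of i j \<Gamma> ?\<beta> p] int by simp
  next
    fix i :: nat assume "i > 0"
    thus "geom_sum \<Gamma> ?\<beta> i 0 = (\<Sum>s\<in>{-1..1}. geom_sum \<Gamma> ?\<beta> (nat (int i - s)) 1 * p s (-1)) +
        (\<Sum>s\<in>{-1..1}. geom_sum \<Gamma> ?\<beta> (nat (int i - s)) 0 * h s)"
      using geom_sum_horizontal[of i \<Gamma> ?\<beta> "\<lambda>s. p s (-1)" h] hor' by simp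
  next
    fix j :: nat assume "j > 0"
    thus "geom_sum \<Gamma> ?\<beta> 0 j = (\<Sum>t\<in>{-1..1}. geom_sum \<Gamma> ?\<beta> 1 (nat (int j - t)) * p (-1) t) +
        (\<Sum>t\<in>{-1..1}. geom_sum \<Gamma> ?\<beta> 0 (nat (int j - t)) * v t)"
      using geom_sum_vertical[of j \<Gamma> ?\<beta> "p (-1)" v] ver' by simp
  qed
qed

lemma balanced_geom_sum_eq_0:
  assumes "quarter_plane_walk p h v" "finite \<Gamma>" "\<Gamma> \<subseteq> walk_curve p"
    and "balanced p h v (geom_sum \<Gamma> \<beta>)" "geom_sum \<Gamma> \<beta> 0 0 = 0" "x \<in> \<Gamma>"
  shows "\<beta> x = 0"
proof (rule geom_sum_eq_0D[OF assms(2) _ assms(6)])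
  fix i j
  have params: "walk_parameters p h v" "irreducible_chain (walk_transition p h v)"
    using assms(1) unfolding quarter_plane_walk_def by auto
  have "\<bar>fst x\<bar> < 1 \<and> \<bar>snd x\<bar> < 1" if "x \<in> \<Gamma>" for x
    using that assms(3) unfolding walk_curve_def by auto
  note summable = geom_sum_abs_summable[OF this]
  have "case_prod (geom_sum \<Gamma> \<beta>) (0, 0) = 0"
    using assms(5) by simp
  from signed_invariant_zero[OF walk_transition_nonneg[OF params(1)]
      walk_transition_row[OF params(1)] params(2) summable balanced_column[OF assms(4)] this]
  have "case_prod (geom_sum \<Gamma> \<beta>) (i, j) = 0" .
  thus "geom_sum \<Gamma> \<beta> i j = 0" by simp
qed

section \<open>Uncoupled splittings\<close>

lemma no_uncoupled_split:
  assumes "quarter_plane_walk p h v" "finite \<Gamma>" "\<Gamma> \<subseteq> walk_curve p"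
    and "balanced p h v (geom_sum \<Gamma> \<alpha>)" "\<And>x. x \<in> \<Gamma> \<Longrightarrow> \<alpha> x \<noteq> 0"
    and "A \<subseteq> \<Gamma>" "a \<in> A" "b \<in> \<Gamma> - A"
    and uncoupled: "\<And>x y. x \<in> A \<Longrightarrow> y \<in> \<Gamma> - A \<Longrightarrow> fst x \<noteq> fst y \<and> snd x \<noteq> snd y"
  shows False
proof -
  define S where "S = (\<Sum>x\<in>A. \<alpha> x)"
  define T where "T = (\<Sum>x\<in>\<Gamma> - A. \<alpha> x)"
  \<comment> \<open>\<open>S\<close> and \<open>T\<close> are the values at the origin of the two
    partial sums; one linear equation in two unknowns has a nontrivial solution.\<close>
  obtain k l where kl: "k * S + l * T = 0" "k \<noteq> 0 \<or> l \<noteq> 0"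
  proof (cases "S = 0")
    case True thus ?thesis using that[of 1 0] by simp
  next
    case False thus ?thesis using that[of T "- S"] by simp
  qed
  define g where "g x = (if x \<in> A then k else l)" for x
  \<comment> \<open>Since no coordinate is shared across the split, either coordinate alone decides
    membership in \<open>A\<close>; hence \<open>g\<close> is a function of each.\<close>
  have "fst x \<in> fst ` A \<longleftrightarrow> x \<in> A" "snd x \<in> snd ` A \<longleftrightarrow> x \<in> A" if "x \<in> \<Gamma>" for x
    using uncoupled[of _ x] that by (metis DiffI imageE imageI)+
  hence bal: "balanced p h v (geom_sum \<Gamma> (\<lambda>x. g x * \<alpha> x))"
    using assms(2-4)
    by (intro balanced_reweight[where F = "\<lambda>\<rho>. if \<rho> \<in> fst ` A then k else l"
          and G = "\<lambda>\<sigma>. if \<sigma> \<in> snd ` A then k else l"]) (auto simp: g_def)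
  have "geom_sum \<Gamma> (\<lambda>x. g x * \<alpha> x) 0 0 = (\<Sum>x\<in>\<Gamma> - A. g x * \<alpha> x) + (\<Sum>x\<in>A. g x * \<alpha> x)"
    unfolding geom_sum_def using sum.subset_diff[OF assms(6,2)] by simp
  also have "\<dots> = l * T + k * S"
    by (simp add: S_def T_def g_def sum_distrib_left)
  finally have "g x * \<alpha> x = 0" if "x \<in> \<Gamma>" for x
    using balanced_geom_sum_eq_0[OF assms(1-3) bal _ that] kl by simp
  \<comment> \<open>The coefficients \<open>\<alpha>\<close> are nonzero, so both weights
    \<open>k\<close> and \<open>l\<close> would have to vanish.\<close>
  hence "g a = 0" "g b = 0" using assms(5-8) by fastforce+
  thus False using kl assms(7,8) by (simp add: g_def)
qed

theorem theorem4:
  fixes p :: "int \<Rightarrow> int \<Rightarrow> real" and h v :: "int \<Rightarrow> real"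
    and m :: "nat \<Rightarrow> nat \<Rightarrow> real" and \<Gamma> :: "(real \<times> real) set"
  assumes "quarter_plane_walk p h v"
    and "invariant_measure p h v m"
    and "finite \<Gamma>"
    and "\<Gamma> \<subseteq> walk_curve p"
    and "\<forall>(\<rho>, \<sigma>)\<in>\<Gamma>. \<rho> > 0 \<and> \<sigma> > 0"
    and "induced_by m \<Gamma>"
  shows "pairwise_coupled \<Gamma>"
proof -
  obtain \<alpha> where \<alpha>: "\<And>x. x \<in> \<Gamma> \<Longrightarrow> \<alpha> x \<noteq> 0"
    and sum: "\<And>i j. ((\<lambda>(\<rho>, \<sigma>). \<alpha> (\<rho>, \<sigma>) * \<rho> ^ i * \<sigma> ^ j) has_sum m i j) \<Gamma>"
    using assms(6) unfolding induced_by_def by blast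
  have "m i j = geom_sum \<Gamma> \<alpha> i j" for i j
    using has_sum_unique[OF sum[of i j] has_sum_finite[OF assms(3)]]
    by (simp add: geom_sum_def case_prod_unfold)
  hence m: "m = geom_sum \<Gamma> \<alpha>" by blast
  have bal: "balanced p h v (geom_sum \<Gamma> \<alpha>)"
    using assms(2) unfolding m invariant_measure_def balanced_def by blast
  \<comment> \<open>An empty \<open>\<Gamma>\<close> would induce the zero measure.\<close>
  have "\<Gamma> \<noteq> {}"
    using assms(2) unfolding m invariant_measure_def by (auto simp: geom_sum_def)
  have "uncoupled_partition \<Gamma> {\<Gamma>}"
    using \<open>\<Gamma> \<noteq> {}\<close> by (auto simp: uncoupled_partition_def partition_on_def)
  moreover have "P = {\<Gamma>}" if P: "uncoupled_partition \<Gamma> P" for P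
  proof -
    have part: "partition_on \<Gamma> P" using P by (simp add: uncoupled_partition_def)
    have "A = \<Gamma>" if "A \<in> P" for A
    proof (rule ccontr)
      assume "A \<noteq> \<Gamma>"
      moreover have "A \<subseteq> \<Gamma>" "A \<noteq> {}" using part \<open>A \<in> P\<close> by (auto simp: partition_on_def)
      ultimately obtain a b where ab: "a \<in> A" "b \<in> \<Gamma> - A" by blast
      have "fst x \<noteq> fst y \<and> snd x \<noteq> snd y" if "x \<in> A" "y \<in> \<Gamma> - A" for x y
      proof -
        \<comment> \<open>The set \<open>B\<close> of the partition that contains \<open>y\<close>
          differs from \<open>A\<close> because \<open>y\<close> lies outside
          \<open>A\<close>.\<close>
        have "y \<in> \<Union>P" using part that by (auto simp: partition_on_def)
        then obtain B where "B \<in> P" "y \<in> B" by blast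
        thus ?thesis using P that \<open>A \<in> P\<close> unfolding uncoupled_partition_def by fastforce
      qed
      thus False using no_uncoupled_split[OF assms(1,3,4) bal \<alpha> \<open>A \<subseteq> \<Gamma>\<close> ab] by blast
    qed
    moreover have "P \<noteq> {}" using part \<open>\<Gamma> \<noteq> {}\<close> by (auto simp: partition_on_def)
    ultimately show ?thesis by blast
  qed
  ultimately have "maximal_uncoupled_partition \<Gamma> {\<Gamma>}"
    unfolding maximal_uncoupled_partition_def by (metis lepoll_refl)
  thus ?thesis unfolding pairwise_coupled_def by (intro exI[of _ "{\<Gamma>}"]) simp
qed

end
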